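(* The optimal value $z^*_{(\mathcal{M})}$ of the network monitoring problem satisfies $$z^*_{(\overline{\mathcal{M}})} = \max_{C \subseteq \mathcal{X}} \min\Big\{1 - \frac{k^*_C-r}{S^{k^*}_C},\ \min_{u \notin U_C}\varphi_u\Big\} \ \leq\ z^*_{(\mathcal{M})}\ \leq\ \min\Big\{1,\ \min_{T \in \mathcal{T}} \Big(1 - \frac{|T|-r}{S_T}\Big)\Big\}.$$ Furthermore, for any set of $n > r$ locations $C = \{x_1,\dots,x_n\}\subseteq \mathcal{X}$ indexed so that $\overline{\varphi}_{x_1}\leq\cdots\leq\overline{\varphi}_{x_n}$, any $\sigma^{1\prime}\in\Delta^1$ satisfying $$\mathbb{P}_{X\sim\sigma^{1\prime}}(x \in X) = \begin{cases} 1 - \dfrac{k^*_C-r}{(1-\overline{\varphi}_{x})S^{k^*}_C}, & \text{if } x \in \{x_1,\dots,x_{k^*_C}\},\\ 0, & \text{otherwise,}\end{cases}\qquad \text{for all } x\in\mathcal{X},$$ is an optimal solution of the problem $(\mathcal{R}_C)$: $\max_{\sigma^1 \in \Delta^1} \min_{x \in C} \mathbb{E}_{X \sim \sigma^1}[\bar{f}(X,x)]$.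
   Context: Setting: $\mathcal{U}$ is a finite set of components and $\mathcal{X}$ a finite set of sensor locations. Each $u\in\mathcal{U}$ has a security level $\varphi_u\in[0,1)$. Each $x\in\mathcal{X}$ has a nonempty monitoring set $U_x\subseteq\mathcal{U}$; for $C\subseteq\mathcal{X}$, $U_C=\bigcup_{x\in C}U_x$; every component belongs to at least one monitoring set, i.e. $U_{\mathcal{X}}=\mathcal{U}$. A set cover is a $C\subseteq\mathcal{X}$ with $U_C=\mathcal{U}$, and $n^*$ is the minimum size of a set cover. The number of sensors is a positive integer $r$ with $r<n^*$. $\mathcal{A}=\{X\subseteq\mathcal{X} : |X|\le r\}$, and $\Delta^1$ is the set of probability distributions $\sigma^1$ on $\mathcal{A}$ (monitoring strategies), $\sigma^1_X$ being the probability of $X$. The node basis of $\sigma^1$ is $\mathcal{X}(\sigma^1)=\bigcup_{X:\sigma^1_X>0}X$. For $X\in\mathcal{A}$, $u\in\mathcal{U}$: $f(X,u)=1$ if $u\in U_X$ and $f(X,u)=\varphi_u$ otherwise. For $x\in\mathcal{X}$: $\overline{\varphi}_x=\min_{u\in U_x}\varphi_u$, and $\bar f(X,x)=1$ if $x\in X$, $\bar f(X,x)=\overline{\varphi}_x$ otherwise. $z^*_{(\mathcal{M})}=\max_{\sigma^1\in\Delta^1}\min_{u\in\mathcal{U}}\mathbb{E}_{X\sim\sigma^1}[f(X,u)]$, and $$z^*_{(\overline{\mathcal{M}})}=\max_{\sigma^1\in\Delta^1}\min\Big\{\min_{x\in\mathcal{X}(\sigma^1)}\mathbb{E}_{X\sim\sigma^1}[\bar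 f(X,x)],\ \min_{u\notin U_{\mathcal{X}(\sigma^1)}}\varphi_u\Big\}.$$ A set packing is a $T\subseteq\mathcal{U}$ with $|T\cap U_x|\le1$ for all $x\in\mathcal{X}$; $\mathcal{T}$ is the collection of set packings. For $T\subseteq\mathcal{U}$, $S_T=\sum_{u\in T}(1-\varphi_u)^{-1}$. For $C=\{x_1,\dots,x_n\}\subseteq\mathcal{X}$ with $|C|=n$ and $\overline{\varphi}_{x_1}\le\cdots\le\overline{\varphi}_{x_n}$, $$k^*_C=\max\Big\{k\in\{1,\dots,n\} : \overline{\varphi}_{x_k}\le 1-\frac{k-r}{\sum_{l=1}^k(1-\overline{\varphi}_{x_l})^{-1}}\Big\},\qquad S^{k^*}_C=\sum_{l=1}^{k^*_C}(1-\overline{\varphi}_{x_l})^{-1}.$$ Conventions: a minimum over an empty set is $+\infty$; for $C=\emptyset$ the quantity $1-\frac{k^*_C-r}{S^{k^*}_C}$ is read as $+\infty$, and for $T=\emptyset$ the quantity $1-\frac{|T|-r}{S_T}$ is read as $+\infty$. *)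

theory Defs
  imports "HOL-Probability.Probability"
begin

text \<open>
  Parameters throughout: \<open>U\<close> is the set of components, \<open>L\<close> the set of sensor locations,
  \<open>mon x\<close> the monitoring set of location \<open>x\<close>, \<open>\<phi> u\<close> the security level of component \<open>u\<close>
  and \<open>r\<close> the number of sensors.

  All optimal values live in \<^typ>\<open>ereal\<close>. Minima that may range over the empty set are
  written as \<open>INF\<close>, which is \<open>\<infinity>\<close> on the empty set and the minimum on finite nonempty sets.
\<close>

definition covered :: "('x \<Rightarrow> 'u set) \<Rightarrow> 'x set \<Rightarrow> 'u set" where
  "covered mon C = (\<Union>x\<in>C. mon x)"

definition set_cover :: "'u set \<Rightarrow> 'x set \<Rightarrow> ('x \<Rightarrow> 'u set) \<Rightarrow> 'x set \<Rightarrow> bool" where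
  "set_cover U L mon C \<longleftrightarrow> C \<subseteq> L \<and> covered mon C = U"

definition min_cover_size :: "'u set \<Rightarrow> 'x set \<Rightarrow> ('x \<Rightarrow> 'u set) \<Rightarrow> nat" where
  "min_cover_size U L mon = Min (card ` {C. set_cover U L mon C})"

definition set_packing :: "'u set \<Rightarrow> 'x set \<Rightarrow> ('x \<Rightarrow> 'u set) \<Rightarrow> 'u set \<Rightarrow> bool" where
  "set_packing U L mon T \<longleftrightarrow> T \<subseteq> U \<and> (\<forall>x\<in>L. card (T \<inter> mon x) \<le> 1)"

definition placements :: "'x set \<Rightarrow> nat \<Rightarrow> 'x set set" where
  "placements L r = {X. X \<subseteq> L \<and> card X \<le> r}"

definition monitoring_strategies :: "'x set \<Rightarrow> nat \<Rightarrow> 'x set pmf set" where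
  "monitoring_strategies L r = {\<sigma>. set_pmf \<sigma> \<subseteq> placements L r}"

definition node_basis :: "'x set pmf \<Rightarrow> 'x set" where
  "node_basis \<sigma> = \<Union> {X. pmf \<sigma> X > 0}"

definition detect :: "('u \<Rightarrow> real) \<Rightarrow> ('x \<Rightarrow> 'u set) \<Rightarrow> 'x set \<Rightarrow> 'u \<Rightarrow> real" where
  "detect \<phi> mon X u = (if u \<in> covered mon X then 1 else \<phi> u)"

definition phi_bar :: "('u \<Rightarrow> real) \<Rightarrow> ('x \<Rightarrow> 'u set) \<Rightarrow> 'x \<Rightarrow> real" where
  "phi_bar \<phi> mon x = Min (\<phi> ` mon x)"

definition detect_bar :: "('u \<Rightarrow> real) \<Rightarrow> ('x \<Rightarrow> 'u set) \<Rightarrow> 'x set \<Rightarrow> 'x \<Rightarrow> real" where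
  "detect_bar \<phi> mon X x = (if x \<in> X then 1 else phi_bar \<phi> mon x)"

definition objective_M ::
    "'u set \<Rightarrow> ('u \<Rightarrow> real) \<Rightarrow> ('x \<Rightarrow> 'u set) \<Rightarrow> 'x set pmf \<Rightarrow> ereal" where
  "objective_M U \<phi> mon \<sigma> =
     (INF u\<in>U. ereal (measure_pmf.expectation \<sigma> (\<lambda>X. detect \<phi> mon X u)))"

definition objective_R ::
    "('u \<Rightarrow> real) \<Rightarrow> ('x \<Rightarrow> 'u set) \<Rightarrow> 'x set \<Rightarrow> 'x set pmf \<Rightarrow> ereal" where
  "objective_R \<phi> mon C \<sigma> =
     (INF x\<in>C. ereal (measure_pmf.expectation \<sigma> (\<lambda>X. detect_bar \<phi> mon X x)))"

definition min_uncovered ::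
    "'u set \<Rightarrow> ('u \<Rightarrow> real) \<Rightarrow> ('x \<Rightarrow> 'u set) \<Rightarrow> 'x set \<Rightarrow> ereal" where
  "min_uncovered U \<phi> mon C = (INF u\<in>U - covered mon C. ereal (\<phi> u))"

definition objective_M_bar ::
    "'u set \<Rightarrow> ('u \<Rightarrow> real) \<Rightarrow> ('x \<Rightarrow> 'u set) \<Rightarrow> 'x set pmf \<Rightarrow> ereal" where
  "objective_M_bar U \<phi> mon \<sigma> =
     min (objective_R \<phi> mon (node_basis \<sigma>) \<sigma>) (min_uncovered U \<phi> mon (node_basis \<sigma>))"

text \<open>
  The optimal values are suprema over the infinite set of strategies; that they are maxima
  is a separate claim, to be expressed by the existence of an \<^const>\<open>is_arg_max\<close>.
\<close>

definition z_M ::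
    "'u set \<Rightarrow> 'x set \<Rightarrow> ('u \<Rightarrow> real) \<Rightarrow> ('x \<Rightarrow> 'u set) \<Rightarrow> nat \<Rightarrow> ereal" where
  "z_M U L \<phi> mon r = (SUP \<sigma>\<in>monitoring_strategies L r. objective_M U \<phi> mon \<sigma>)"

definition z_M_bar ::
    "'u set \<Rightarrow> 'x set \<Rightarrow> ('u \<Rightarrow> real) \<Rightarrow> ('x \<Rightarrow> 'u set) \<Rightarrow> nat \<Rightarrow> ereal" where
  "z_M_bar U L \<phi> mon r = (SUP \<sigma>\<in>monitoring_strategies L r. objective_M_bar U \<phi> mon \<sigma>)"

definition packing_sum :: "('u \<Rightarrow> real) \<Rightarrow> 'u set \<Rightarrow> real" where
  "packing_sum \<phi> T = (\<Sum>u\<in>T. inverse (1 - \<phi> u))"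

definition packing_bound :: "('u \<Rightarrow> real) \<Rightarrow> nat \<Rightarrow> 'u set \<Rightarrow> ereal" where
  "packing_bound \<phi> r T =
     (if T = {} then \<infinity> else ereal (1 - (real (card T) - real r) / packing_sum \<phi> T))"

text \<open>
  \<open>k\<^sup>*\<^sub>C\<close> and \<open>S\<^sup>k\<^sup>*\<^sub>C\<close> depend on an increasing enumeration of \<open>C\<close> only through the increasingly
  sorted list of the values of \<^const>\<open>phi_bar\<close> on \<open>C\<close> (with multiplicity), so that list is
  used and no choice among tied enumerations is needed; see \<open>sorted_phi_bars_eq\<close>.
  List positions start at 0, hence the \<open>k\<close>-th value is at position \<open>k - 1\<close>.
\<close>

definition sorted_phi_bars ::
    "('u \<Rightarrow> real) \<Rightarrow> ('x \<Rightarrow> 'u set) \<Rightarrow> 'x set \<Rightarrow> real list" where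
  "sorted_phi_bars \<phi> mon C =
     sorted_list_of_multiset (image_mset (phi_bar \<phi> mon) (mset_set C))"

lemma sorted_phi_bars_eq:
  assumes "distinct xs" and "set xs = C" and "sorted (map (phi_bar \<phi> mon) xs)"
  shows "sorted_phi_bars \<phi> mon C = map (phi_bar \<phi> mon) xs"
proof -
  have "image_mset (phi_bar \<phi> mon) (mset_set C) = mset (map (phi_bar \<phi> mon) xs)"
    using assms(1,2) mset_set_set by fastforce
  then show ?thesis
    using assms(3) by (simp add: sorted_phi_bars_def sorted_sort_id del: mset_map)
qed

definition partial_S ::
    "('u \<Rightarrow> real) \<Rightarrow> ('x \<Rightarrow> 'u set) \<Rightarrow> 'x set \<Rightarrow> nat \<Rightarrow> real" where
  "partial_S \<phi> mon C k = (\<Sum>l=1..k. inverse (1 - sorted_phi_bars \<phi> mon C ! (l - 1)))"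

definition k_star ::
    "('u \<Rightarrow> real) \<Rightarrow> ('x \<Rightarrow> 'u set) \<Rightarrow> nat \<Rightarrow> 'x set \<Rightarrow> nat" where
  "k_star \<phi> mon r C =
     Max {k \<in> {1..card C}.
       sorted_phi_bars \<phi> mon C ! (k - 1) \<le> 1 - (real k - real r) / partial_S \<phi> mon C k}"

definition S_star ::
    "('u \<Rightarrow> real) \<Rightarrow> ('x \<Rightarrow> 'u set) \<Rightarrow> nat \<Rightarrow> 'x set \<Rightarrow> real" where
  "S_star \<phi> mon r C = partial_S \<phi> mon C (k_star \<phi> mon r C)"

definition cover_bound ::
    "('u \<Rightarrow> real) \<Rightarrow> ('x \<Rightarrow> 'u set) \<Rightarrow> nat \<Rightarrow> 'x set \<Rightarrow> ereal" where
  "cover_bound \<phi> mon r C =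
     (if C = {} then \<infinity>
      else ereal (1 - (real (k_star \<phi> mon r C) - real r) / S_star \<phi> mon r C))"

end

theory Submission
  imports Defs
begin

text \<open>
  Both sides of the bound come from one budget: a strategy uses at most \<open>r\<close> sensors, so detection
  probabilities that are served by different sensors add up to at most \<open>r\<close>.

  Let \<open>p u\<close> be the probability that \<open>u\<close> is monitored. Its expected security is
  \<open>1 - (1 - p u) * (1 - \<phi> u)\<close>, so guaranteeing security \<open>v\<close> at \<open>u\<close> requires
  \<open>1 - p u \<le> (1 - v) / (1 - \<phi> u)\<close>. Summing over a set \<open>T\<close> whose members compete for sensors gives
  \<open>card T - r \<le> (1 - v) * S\<close> with \<open>S\<close> the sum of the weights \<open>1 / (1 - \<phi> u)\<close>, which is \<open>level_bound\<close>.
  The elements of a set packing compete because one sensor covers at most one of them; this is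
  the upper bound on \<^const>\<open>z_M\<close>. The locations themselves compete trivially; this bounds
  \<^const>\<open>objective_R\<close>.

  For a set \<open>C\<close> of more than \<open>r\<close> locations the bound is attained by water filling: raise the values
  \<^const>\<open>phi_bar\<close> of the \<open>k\<^sup>*\<close> lowest locations to one common level \<open>v\<close> and leave the others, which
  already exceed \<open>v\<close>, alone (locale \<open>water_filling\<close>). The probabilities needed lie in \<open>[0, 1]\<close> and use
  the budget \<open>r\<close> exactly. Since \<open>r\<close> is an integer, some distribution over sets of at most \<open>r\<close>
  locations has these marginals (\<open>realizable_if_sum_le\<close>). Locations of \<open>C\<close> that drop out of the node
  basis do no harm in the restricted problem, as the components they would have covered have
  security at least \<open>v\<close> without monitoring. A set of at most \<open>r\<close> locations can be occupied entirely;
  it is no cover, so only the components it leaves uncovered matter.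

  The restricted objective never exceeds the original one because the value of a location is that
  of its least secure component. The restricted maximum then runs over finitely many node bases,
  while the original maximum exists by compactness of the simplex of strategies
  (\<open>maximin_pmf_attained\<close>).
\<close>

section \<open>The sensor budget\<close>

lemma integrable_indicator_pmf: "integrable (measure_pmf \<sigma>) (indicat_real A)"
  by (rule measure_pmf.integrable_const_bound[where B = 1]) (auto simp: indicator_def)

lemma expectation_if_one:
  "measure_pmf.expectation \<sigma> (\<lambda>X. if P X then 1 else c)
     = 1 - (1 - measure_pmf.prob \<sigma> {X. P X}) * (1 - c)"
proof -
  have "measure_pmf.expectation \<sigma> (\<lambda>X. if P X then 1 else c)
      = measure_pmf.expectation \<sigma> (\<lambda>X. c + (1 - c) * indicat_real {X. P X} X)"
    by (intro arg_cong[where f = "measure_pmf.expectation \<sigma>"]) (auto simp: indicator_def)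
  also have "\<dots> = c + (1 - c) * measure_pmf.prob \<sigma> {X. P X}"
    by (subst Bochner_Integration.integral_add) (simp_all add: integrable_indicator_pmf)
  finally show ?thesis
    by (simp add: algebra_simps)
qed

text \<open>
  The sum of the probabilities is the expected number of events that occur.
\<close>

lemma sum_prob_le:
  assumes "finite T" and "\<And>X. X \<in> set_pmf \<sigma> \<Longrightarrow> card {u \<in> T. P X u} \<le> r"
  shows "(\<Sum>u\<in>T. measure_pmf.prob \<sigma> {X. P X u}) \<le> real r"
proof -
  have count: "(\<Sum>u\<in>T. indicat_real {X. P X u} X) = real (card {u \<in> T. P X u})" for X
    using assms(1) by (simp add: indicator_def sum.If_cases Int_def)
  have "(\<Sum>u\<in>T. measure_pmf.prob \<sigma> {X. P X u})
      = measure_pmf.expectation \<sigma> (\<lambda>X. \<Sum>u\<in>T. indicat_real {X. P X u} X)"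
    by (subst Bochner_Integration.integral_sum) (simp_all add: integrable_indicator_pmf)
  also have "\<dots> \<le> real r"
  proof (rule measure_pmf.integral_le_const)
    show "integrable (measure_pmf \<sigma>) (\<lambda>X. \<Sum>u\<in>T. indicat_real {X. P X u} X)"
      by (intro Bochner_Integration.integrable_sum integrable_indicator_pmf)
    show "AE X in measure_pmf \<sigma>. (\<Sum>u\<in>T. indicat_real {X. P X u} X) \<le> real r"
      using assms(2) unfolding count by (simp add: AE_measure_pmf_iff)
  qed
  finally show ?thesis .
qed

text \<open>
  If all terms exceeded a value \<open>v\<close>, then \<open>1 - p u < (1 - v) / (1 - \<psi> u)\<close> for all \<open>u\<close>; the sum of these
  inequalities contradicts the budget exactly for the \<open>v\<close> on the right-hand side.
\<close>

lemma level_bound: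
  fixes p \<psi> :: "'a \<Rightarrow> real"
  assumes "finite T" and "T \<noteq> {}" and \<psi>: "\<And>u. u \<in> T \<Longrightarrow> \<psi> u < 1" and p: "sum p T \<le> real r"
  shows "(INF u\<in>T. ereal (1 - (1 - p u) * (1 - \<psi> u)))
           \<le> ereal (1 - (real (card T) - real r) / (\<Sum>u\<in>T. inverse (1 - \<psi> u)))"
    (is "_ \<le> ereal ?v")
proof (rule ccontr)
  let ?S = "\<Sum>u\<in>T. inverse (1 - \<psi> u)"
  have pos: "?S > 0"
    using assms(1-3) by (intro sum_pos) auto
  assume "\<not> ?thesis"
  then have v: "?v < 1 - (1 - p u) * (1 - \<psi> u)" if "u \<in> T" for u
    using less_INF_D[OF _ that, of "ereal ?v" "\<lambda>u. ereal (1 - (1 - p u) * (1 - \<psi> u))"]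
    by (simp add: not_le)
  have "1 - p u < (1 - ?v) * inverse (1 - \<psi> u)" if "u \<in> T" for u
  proof -
    have "(1 - p u) * (1 - \<psi> u) < 1 - ?v"
      using v[OF that] by linarith
    then show ?thesis
      using \<psi>[OF that] by (subst divide_inverse[symmetric], subst pos_less_divide_eq) auto
  qed
  then have "(\<Sum>u\<in>T. 1 - p u) < (\<Sum>u\<in>T. (1 - ?v) * inverse (1 - \<psi> u))"
    by (intro sum_strict_mono) (use assms(1,2) in auto)
  also have "\<dots> = (1 - ?v) * ?S"
    by (simp only: sum_distrib_left)
  also have "\<dots> = real (card T) - real r"
    using pos by simp
  finally show False
    using p by (simp add: sum_subtractf)
qed

section \<open>Random sets with prescribed marginals\<close>

definition realizable :: "'x set \<Rightarrow> nat \<Rightarrow> ('x \<Rightarrow> real) \<Rightarrow> bool" where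
  "realizable D r p \<longleftrightarrow>
     (\<exists>\<sigma>\<in>monitoring_strategies D r. \<forall>x\<in>D. measure_pmf.prob \<sigma> {X. x \<in> X} = p x)"

lemma finite_placements: "finite D \<Longrightarrow> finite (placements D r)"
  by (simp add: placements_def)

lemma realizable_indicator:
  assumes "A \<subseteq> D" and "card A \<le> r" and "\<And>x. x \<in> D \<Longrightarrow> p x = (if x \<in> A then 1 else 0)"
  shows "realizable D r p"
  unfolding realizable_def
  using assms
  by (intro bexI[of _ "return_pmf A"])
    (auto simp: monitoring_strategies_def placements_def indicator_def)

lemma realizable_mixture:
  assumes "finite D" and "realizable D r p1" and "realizable D r p2" and q: "0 \<le> q" "q \<le> 1"
    and p: "\<And>x. x \<in> D \<Longrightarrow> p x = q * p1 x + (1 - q) * p2 x"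
  shows "realizable D r p"
proof -
  obtain \<sigma>1 \<sigma>2 where
    \<sigma>1: "set_pmf \<sigma>1 \<subseteq> placements D r" "\<And>x. x \<in> D \<Longrightarrow> measure_pmf.prob \<sigma>1 {X. x \<in> X} = p1 x" and
    \<sigma>2: "set_pmf \<sigma>2 \<subseteq> placements D r" "\<And>x. x \<in> D \<Longrightarrow> measure_pmf.prob \<sigma>2 {X. x \<in> X} = p2 x"
    using assms(2,3) unfolding realizable_def monitoring_strategies_def by blast
  define \<sigma> where "\<sigma> = bind_pmf (bernoulli_pmf q) (\<lambda>b. if b then \<sigma>1 else \<sigma>2)"
  have fin: "finite (set_pmf \<sigma>1)" "finite (set_pmf \<sigma>2)"
    using \<sigma>1(1) \<sigma>2(1) finite_placements[OF assms(1)] finite_subset by blast+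
  have prob: "measure_pmf.prob \<sigma> A = q * measure_pmf.prob \<sigma>1 A + (1 - q) * measure_pmf.prob \<sigma>2 A" for A
  proof -
    have "measure_pmf.prob \<sigma> A = measure_pmf.expectation \<sigma> (indicat_real A)"
      by simp
    also have "\<dots> = (\<Sum>b\<in>UNIV. pmf (bernoulli_pmf q) b
        *\<^sub>R measure_pmf.expectation (if b then \<sigma>1 else \<sigma>2) (indicat_real A))"
      unfolding \<sigma>_def by (rule pmf_expectation_bind) (use fin in auto)
    finally show ?thesis
      using q by (simp add: UNIV_bool)
  qed
  have "set_pmf \<sigma> \<subseteq> placements D r"
    using \<sigma>1(1) \<sigma>2(1) by (auto simp: \<sigma>_def split: if_splits)
  then show ?thesis
    unfolding realizable_def monitoring_strategies_def using \<sigma>1(2) \<sigma>2(2) p prob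
    by (intro bexI[of _ \<sigma>]) auto
qed

text \<open>
  The integrality of \<open>r\<close> enters here: the vectors in the unit cube with coordinate sum at most \<open>r\<close> are
  convex combinations of indicator vectors of sets with at most \<open>r\<close> elements. Two fractional
  coordinates can exchange mass in either direction until one of them becomes integral, and the
  vector lies between the two results, which have fewer fractional coordinates. A single
  fractional coordinate fits on top of the integral ones because it leaves at least one unit of
  the budget unused.
\<close>

lemma realizable_if_sum_le:
  fixes p :: "'x \<Rightarrow> real"
  assumes "finite D" and "\<And>x. x \<in> D \<Longrightarrow> 0 \<le> p x \<and> p x \<le> 1" and "sum p D \<le> real r"
  shows "realizable D r p"
  using assms(2,3)
proof (induction "card {x \<in> D. 0 < p x \<and> p x < 1}" arbitrary: p rule: less_induct)
  case less
  define F where "F = {x \<in> D. 0 < p x \<and> p x < 1}"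
  define A where "A = {x \<in> D. p x = 1}"
  have AD: "x \<in> D" if "x \<in> A" for x
    using that by (simp add: A_def)
  have finF: "finite F" and finA: "finite A"
    using assms(1) by (auto simp: F_def A_def)
  have zero: "p x = 0" if "x \<in> D" "x \<notin> A" "x \<notin> F" for x
    using less.prems(1)[OF that(1)] that by (force simp: A_def F_def)
  have "sum p D = sum p (A \<union> F)"
    by (rule sum.mono_neutral_right) (use assms(1) zero in \<open>auto simp: A_def F_def\<close>)
  also have "\<dots> = real (card A) + sum p F"
    using finA finF by (subst sum.union_disjoint) (auto simp: A_def F_def)
  finally have mass: "real (card A) + sum p F \<le> real r"
    using less.prems(2) by simp
  consider "F = {}" | i where "F = {i}" | i j where "i \<in> F" "j \<in> F" "i \<noteq> j"
    by blast
  then show ?case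
  proof cases
    case 1
    then show ?thesis
      using mass zero by (intro realizable_indicator[of A]) (auto simp: A_def)
  next
    case 2
    then have i: "i \<in> D" "0 < p i" "p i < 1" "i \<notin> A"
      by (auto simp: F_def A_def)
    have "card A < r"
      using mass 2 i(2) by simp
    then have "realizable D r (\<lambda>x. if x \<in> insert i A then 1 else 0)"
      using finA i AD by (intro realizable_indicator[of "insert i A"]) auto
    moreover have "realizable D r (\<lambda>x. if x \<in> A then 1 else 0)"
      using \<open>card A < r\<close> AD by (intro realizable_indicator[of A]) auto
    ultimately show ?thesis
      by (rule realizable_mixture[where q = "p i", OF assms(1)])
        (use i zero 2 in \<open>auto simp: A_def\<close>)
  next
    case 3
    then have ij: "i \<in> D" "j \<in> D" "i \<noteq> j" "0 < p i" "p i < 1" "0 < p j" "p j < 1"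
      by (auto simp: F_def)
    \<comment> \<open>the largest amounts that can be moved from \<open>j\<close> to \<open>i\<close> and from \<open>i\<close> to \<open>j\<close>\<close>
    define \<delta> where "\<delta> = min (1 - p i) (p j)"
    define \<epsilon> where "\<epsilon> = min (p i) (1 - p j)"
    define move where "move t = p(i := p i + t, j := p j - t)" for t
    have pos: "\<delta> > 0" "\<epsilon> > 0"
      using ij by (auto simp: \<delta>_def \<epsilon>_def)
    have sum_move: "sum (move t) D = sum p D" for t
    proof -
      have "sum (move t) D = (\<Sum>x\<in>D. p x + (if x = i then t else 0) - (if x = j then t else 0))"
        using ij(3) by (intro sum.cong) (auto simp: move_def)
      then show ?thesis
        using ij(1,2) assms(1) by (simp add: sum.distrib sum_subtractf)
    qed
    have step: "realizable D r (move t)"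
      if range: "0 \<le> p i + t" "p i + t \<le> 1" "0 \<le> p j - t" "p j - t \<le> 1"
        and ext: "p i + t \<in> {0, 1} \<or> p j - t \<in> {0, 1}" for t
    proof (rule less.hyps)
      have "{x \<in> D. 0 < move t x \<and> move t x < 1} \<subset> F"
        using ext ij 3 by (force simp: move_def F_def)
      then show "card {x \<in> D. 0 < move t x \<and> move t x < 1} < card {x \<in> D. 0 < p x \<and> p x < 1}"
        using finF psubset_card_mono by (auto simp: F_def)
      show "0 \<le> move t x \<and> move t x \<le> 1" if "x \<in> D" for x
        using range less.prems(1)[OF that] by (simp add: move_def)
      show "sum (move t) D \<le> real r"
        using less.prems(2) by (simp add: sum_move)
    qed
    have "realizable D r (move \<delta>)" "realizable D r (move (- \<epsilon>))"
      using ij by (auto intro!: step simp: \<delta>_def \<epsilon>_def min_def)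
    then show ?thesis
    proof (rule realizable_mixture[where q = "\<epsilon> / (\<delta> + \<epsilon>)", OF assms(1)])
      show "p x = \<epsilon> / (\<delta> + \<epsilon>) * move \<delta> x + (1 - \<epsilon> / (\<delta> + \<epsilon>)) * move (- \<epsilon>) x" for x
        using pos by (simp add: move_def divide_simps) (simp add: algebra_simps)
    qed (use pos in auto)
  qed
qed

section \<open>The water level\<close>

lemma partial_S_eq_sum:
  assumes "distinct xs" and "set xs = C" and "sorted (map (phi_bar \<phi> mon) xs)"
    and "k \<le> card C"
  shows "partial_S \<phi> mon C k = (\<Sum>x\<in>set (take k xs). inverse (1 - phi_bar \<phi> mon x))"
proof -
  have k: "k \<le> length xs"
    using assms distinct_card by fastforce
  have "partial_S \<phi> mon C k = (\<Sum>i<k. inverse (1 - sorted_phi_bars \<phi> mon C ! i))"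
    unfolding partial_S_def by (rule sum.reindex_bij_witness[of _ Suc "\<lambda>l. l - 1"]) auto
  also have "\<dots> = (\<Sum>i<k. inverse (1 - phi_bar \<phi> mon (xs ! i)))"
    using k by (simp add: sorted_phi_bars_eq[OF assms(1-3)])
  also have "\<dots> = (\<Sum>x\<in>(!) xs ` {..<k}. inverse (1 - phi_bar \<phi> mon x))"
    using k assms(1) by (subst sum.reindex) (auto intro: inj_on_nth)
  also have "(!) xs ` {..<k} = set (take k xs)"
    using k by (metis atLeast0LessThan nth_image)
  finally show ?thesis .
qed

text \<open>
  The list \<open>xs\<close> is an increasing enumeration of \<open>C\<close>. Its \<open>head\<close> consists of the locations whose
  values are raised to the common \<open>level\<close>; \<open>k\<^sup>*\<close> is the right length of the head because the
  largest value in it is still below the level, whereas every other location already lies above.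
\<close>

locale water_filling =
  fixes \<phi> :: "'u \<Rightarrow> real" and mon :: "'x \<Rightarrow> 'u set" and r :: nat
    and C :: "'x set" and xs :: "'x list"
  assumes nonempty: "C \<noteq> {}" and less_one: "\<And>x. x \<in> C \<Longrightarrow> phi_bar \<phi> mon x < 1"
    and r_pos: "0 < r"
    and xs: "distinct xs" "set xs = C" "sorted (map (phi_bar \<phi> mon) xs)"
begin

abbreviation "b \<equiv> phi_bar \<phi> mon"
abbreviation "k \<equiv> k_star \<phi> mon r C"
abbreviation "head \<equiv> set (take k xs)"
abbreviation "S \<equiv> partial_S \<phi> mon C"
abbreviation "level \<equiv> 1 - (real k - real r) / S_star \<phi> mon r C"

abbreviation "admissible \<equiv>
  {j \<in> {1..length xs}. b (xs ! (j - 1)) \<le> 1 - (real j - real r) / S j}"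

lemma length_xs: "length xs = card C"
  using xs distinct_card by metis

lemma S_eq: "j \<le> length xs \<Longrightarrow> S j = (\<Sum>x\<in>set (take j xs). inverse (1 - b x))"
  using partial_S_eq_sum[OF xs] length_xs by metis

lemma k_star_eq_Max: "k = Max admissible"
  unfolding k_star_def sorted_phi_bars_eq[OF xs] length_xs[symmetric]
  by (intro arg_cong[where f = Max] Collect_cong) auto

lemma S_nonneg: "j \<le> length xs \<Longrightarrow> S j \<ge> 0"
  using less_one xs(2) by (auto simp: S_eq less_imp_le dest!: in_set_takeD intro!: sum_nonneg)

text \<open>
  With at most \<open>r\<close> locations the level is at least 1, hence \<open>k\<^sup>*\<close> is well defined and reaches \<open>r\<close>
  whenever \<open>C\<close> has so many elements.
\<close>

lemma admissible_if_le:
  assumes "1 \<le> j" "j \<le> r" "j \<le> length xs"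
  shows "j \<in> admissible"
proof -
  have "b (xs ! (j - 1)) \<le> 1"
    using less_one xs(2) assms nth_mem[of "j - 1" xs] by (force simp: less_imp_le)
  also have "1 \<le> 1 - (real j - real r) / S j"
    using assms S_nonneg[of j] by (simp add: divide_le_0_iff)
  finally show ?thesis
    using assms by simp
qed

lemma k_star_admissible: "k \<in> admissible"
proof -
  have "1 \<in> admissible"
    using nonempty xs(2) r_pos by (intro admissible_if_le) (auto simp: Suc_le_eq)
  then show ?thesis
    unfolding k_star_eq_Max by (intro Max_in) auto
qed

lemma k_star_le: "k \<le> card C" and k_star_pos: "0 < k"
  using k_star_admissible length_xs by auto

lemma le_k_star: "r \<le> card C \<Longrightarrow> r \<le> k"
  unfolding k_star_eq_Max using admissible_if_le[of r] r_pos length_xs by (intro Max_ge) auto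

lemma head_subset: "head \<subseteq> C"
  using xs(2) set_take_subset by force

lemma card_head: "card head = k"
  using xs(1) k_star_le length_xs by (simp add: distinct_card)

lemma S_star_eq: "S_star \<phi> mon r C = (\<Sum>x\<in>head. inverse (1 - b x))"
  unfolding S_star_def using S_eq k_star_le length_xs by simp

lemma S_star_pos: "0 < S_star \<phi> mon r C"
  unfolding S_star_eq
proof (rule sum_pos)
  show "head \<noteq> {}"
    using card_head k_star_pos by (metis card.empty less_irrefl)
qed (use less_one head_subset in auto)

lemma head_le_level:
  assumes "x \<in> head"
  shows "b x \<le> level"
proof -
  obtain i where i: "i < k" "x = xs ! i"
    using assms k_star_le length_xs by (auto simp: in_set_conv_nth)
  have "b (xs ! i) \<le> b (xs ! (k - 1))"
    using sorted_nth_mono[OF xs(3), of i "k - 1"] i(1) k_star_le length_xs by simp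
  also have "\<dots> \<le> level"
    using k_star_admissible by (simp add: S_star_def)
  finally show ?thesis
    using i(2) by simp
qed

text \<open>
  Let \<open>y\<close> be the first location after the head. Maximality of \<open>k\<^sup>*\<close> says that \<open>y\<close> lies above the level computed
  with \<open>y\<close> included. The weight of \<open>y\<close> contributes exactly 1 to \<open>(1 - b y) * S (k + 1)\<close>, which cancels
  the increase of \<open>k\<close>, so \<open>y\<close> lies above the level computed without it as well.
\<close>

lemma level_less_tail:
  assumes x: "x \<in> C - head"
  shows "level < b x"
proof -
  obtain i where i: "i < length xs" "x = xs ! i"
    using x xs(2) by (auto simp: in_set_conv_nth)
  have "k \<le> i"
  proof (rule ccontr)
    assume "\<not> k \<le> i"
    then have "xs ! i \<in> head"
      using i(1) by (auto simp: in_set_conv_nth intro!: exI[of _ i])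
    then show False
      using x i(2) by simp
  qed
  then have k: "k < length xs"
    using i(1) by simp
  let ?y = "xs ! k"
  have y: "b ?y < 1"
    using less_one xs(2) k by auto
  have "?y \<notin> head"
    using k xs(1) by (auto simp: in_set_conv_nth nth_eq_iff_index_eq)
  then have Suc_k: "S (Suc k) = S k + inverse (1 - b ?y)"
    using k by (simp add: S_eq take_Suc_conv_app_nth)
  have Sk: "S k > 0"
    using S_star_pos by (simp add: S_star_def)
  have "Suc k \<notin> admissible"
    using Max_ge[of admissible "Suc k"] unfolding k_star_eq_Max[symmetric] by auto
  then have "1 - (real (Suc k) - real r) / S (Suc k) < b ?y"
    using k by simp
  moreover have "S (Suc k) > 0"
    using Sk y unfolding Suc_k by (simp add: add_pos_pos)
  ultimately have "(1 - b ?y) * S (Suc k) < real (Suc k) - real r"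
    by (simp add: field_simps)
  then have "(1 - b ?y) * S k < real k - real r"
    using y unfolding Suc_k by (simp add: distrib_left)
  then have "level < b ?y"
    using Sk by (simp add: S_star_def field_simps)
  also have "\<dots> \<le> b x"
    using sorted_nth_mono[OF xs(3), of k i] i \<open>k \<le> i\<close> by simp
  finally show ?thesis .
qed

end

section \<open>Existence of maximin distributions\<close>

text \<open>
  The maximum of a minimum of linear functions is a linear programme: maximise \<open>t\<close> over the pairs
  \<open>(p, t)\<close> with \<open>t\<close> below every expectation under \<open>p\<close>. The bound on \<open>g\<close> confines \<open>t\<close> to an interval, so the
  feasible set is compact in the product topology on functions.
\<close>

lemma maximin_pmf_attained:
  fixes g :: "'a \<Rightarrow> 'b \<Rightarrow> real"
  assumes A: "finite A" "A \<noteq> {}" and U: "finite U" "U \<noteq> {}"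
    and B: "\<And>a u. a \<in> A \<Longrightarrow> u \<in> U \<Longrightarrow> \<bar>g a u\<bar> \<le> B"
  shows "\<exists>\<sigma>. is_arg_max (\<lambda>\<sigma>. INF u\<in>U. ereal (measure_pmf.expectation \<sigma> (\<lambda>a. g a u)))
               (\<lambda>\<sigma>. set_pmf \<sigma> \<subseteq> A) \<sigma>"
proof -
  define E where "E p u = (\<Sum>a\<in>A. p a * g a u)" for p u
  \<comment> \<open>Forcing \<open>p\<close> to vanish outside \<open>A\<close> makes it a mass function on the whole type.\<close>
  define K where "K = PiE UNIV (\<lambda>a. if a \<in> A then {0..1::real} else {0})
      \<times> {- B..B} \<inter> {(p, t). sum p A = 1 \<and> (\<forall>u\<in>U. t \<le> E p u)}"
  have expectation: "measure_pmf.expectation \<sigma> (\<lambda>a. g a u) = E (pmf \<sigma>) u"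
    if "set_pmf \<sigma> \<subseteq> A" for \<sigma> u
    unfolding E_def using that by (subst integral_measure_pmf[OF A(1)]) auto
  have bounds: "\<bar>E (pmf \<sigma>) u\<bar> \<le> B" if \<sigma>: "set_pmf \<sigma> \<subseteq> A" and u: "u \<in> U" for \<sigma> u
  proof -
    have "\<bar>E (pmf \<sigma>) u\<bar> \<le> (\<Sum>a\<in>A. pmf \<sigma> a * B)"
      unfolding E_def by (rule order_trans[OF sum_abs])
        (auto simp: abs_mult intro!: sum_mono mult_left_mono B u)
    also have "\<dots> = B"
      using sum_pmf_eq_1[OF A(1) \<sigma>] by (simp flip: sum_distrib_right)
    finally show ?thesis .
  qed
  have in_K: "(pmf \<sigma>, t) \<in> K"
    if "set_pmf \<sigma> \<subseteq> A" and "\<And>u. u \<in> U \<Longrightarrow> t \<le> E (pmf \<sigma>) u" and "- B \<le> t" for \<sigma> t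
  proof -
    obtain u where "u \<in> U"
      using U(2) by blast
    then have "t \<le> B"
      using that(2)[of u] bounds[OF that(1), of u] by simp
    moreover have "pmf \<sigma> a = 0" if "a \<notin> A" for a
      using that \<open>set_pmf \<sigma> \<subseteq> A\<close> by (auto simp: pmf_eq_0_set_pmf)
    ultimately show ?thesis
      using that sum_pmf_eq_1[OF A(1) that(1)] by (auto simp: K_def pmf_le_1)
  qed
  have "compact (PiE UNIV (\<lambda>a. if a \<in> A then {0..1::real} else {0}))"
    using compactin_PiE[of "\<lambda>_. euclidean" UNIV "\<lambda>a. if a \<in> A then {0..1::real} else {0}"]
    by (simp add: euclidean_product_topology)
  moreover have "closed {(p, t). sum p A = 1 \<and> (\<forall>u\<in>U. t \<le> E p u)}"
  proof -
    have coord: "continuous_on UNIV (\<lambda>x::('a \<Rightarrow> real) \<times> real. fst x a)" for a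
      by (rule continuous_on_product_then_coordinatewise) (intro continuous_intros)
    have "closed {x::('a \<Rightarrow> real) \<times> real. sum (fst x) A = 1}"
      by (intro closed_Collect_eq continuous_intros coord)
    moreover have "closed {x::('a \<Rightarrow> real) \<times> real. \<forall>u\<in>U. snd x \<le> E (fst x) u}"
      unfolding E_def Ball_def
      by (intro closed_Collect_all closed_Collect_imp open_Collect_const closed_Collect_le continuous_intros coord)
    ultimately show ?thesis
      by (simp add: case_prod_unfold closed_Collect_conj)
  qed
  ultimately have "compact K"
    unfolding K_def by (intro compact_Int_closed compact_Times) auto
  moreover have "K \<noteq> {}"
  proof -
    obtain a where "a \<in> A"
      using A(2) by blast
    then have "(pmf (return_pmf a), - B) \<in> K"
      using bounds[of "return_pmf a"] by (intro in_K) (force simp: abs_le_iff)+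
    then show ?thesis
      by blast
  qed
  ultimately obtain p t where pt: "(p, t) \<in> K" "\<And>q s. (q, s) \<in> K \<Longrightarrow> s \<le> t"
    using continuous_attains_sup[of K snd] by (force intro: continuous_intros)
  have p: "0 \<le> p a" "a \<notin> A \<Longrightarrow> p a = 0" for a
    using pt(1) by (auto simp: K_def PiE_def Pi_def split: if_splits dest!: spec[of _ a])
  have nn: "(\<integral>\<^sup>+ a. ennreal (p a) \<partial>count_space UNIV) = 1"
  proof -
    have "(\<integral>\<^sup>+ a. ennreal (p a) \<partial>count_space UNIV) = (\<Sum>a\<in>A. ennreal (p a))"
      using A(1) p by (intro nn_integral_count_space') auto
    also have "\<dots> = 1"
      using pt(1) p by (simp add: K_def sum_ennreal)
    finally show ?thesis .
  qed
  define \<sigma> where "\<sigma> = embed_pmf p"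
  have pmf_\<sigma>: "pmf \<sigma> = p"
    unfolding \<sigma>_def using pmf_embed_pmf[OF p(1) nn] by blast
  have \<sigma>: "set_pmf \<sigma> \<subseteq> A"
    using p(2) pmf_\<sigma> by (auto simp: set_pmf_eq)
  have "(INF u\<in>U. ereal (E (pmf \<tau>) u)) \<le> (INF u\<in>U. ereal (E (pmf \<sigma>) u))"
    if \<tau>: "set_pmf \<tau> \<subseteq> A" for \<tau>
  proof -
    define s where "s = Min (E (pmf \<tau>) ` U)"
    have "s \<in> E (pmf \<tau>) ` U"
      unfolding s_def using U by (intro Min_in) auto
    then obtain u where u: "u \<in> U" "s = E (pmf \<tau>) u"
      by blast
    have "s \<le> E (pmf \<tau>) u'" if "u' \<in> U" for u'
      using U that by (simp add: s_def)
    then have "(pmf \<tau>, s) \<in> K"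
      using u bounds[OF \<tau> u(1)] by (intro in_K \<tau>) auto
    then have "s \<le> t"
      by (rule pt(2))
    have "(INF u\<in>U. ereal (E (pmf \<tau>) u)) \<le> ereal s"
      using u by (auto intro: INF_lower)
    also have "\<dots> \<le> ereal t"
      using \<open>s \<le> t\<close> by simp
    also have "\<dots> \<le> (INF u\<in>U. ereal (E (pmf \<sigma>) u))"
      using pt(1) by (auto simp: pmf_\<sigma> K_def intro: INF_greatest)
    finally show ?thesis .
  qed
  then show ?thesis
    using \<sigma> by (intro exI[of _ \<sigma>]) (simp add: is_arg_max_linorder expectation)
qed

section \<open>Monitoring networks\<close>

lemma expectation_detect:
  "measure_pmf.expectation \<sigma> (\<lambda>X. detect \<phi> mon X u)
     = 1 - (1 - measure_pmf.prob \<sigma> {X. u \<in> covered mon X}) * (1 - \<phi> u)"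
  unfolding detect_def by (rule expectation_if_one)

lemma expectation_detect_bar:
  "measure_pmf.expectation \<sigma> (\<lambda>X. detect_bar \<phi> mon X x)
     = 1 - (1 - measure_pmf.prob \<sigma> {X. x \<in> X}) * (1 - phi_bar \<phi> mon x)"
  unfolding detect_bar_def by (rule expectation_if_one)

lemma node_basis_eq: "node_basis \<sigma> = \<Union> (set_pmf \<sigma>)"
  unfolding node_basis_def by (simp add: pmf_positive_iff)

lemma prob_eq_0_iff_not_node_basis:
  "measure_pmf.prob \<sigma> {X. x \<in> X} = 0 \<longleftrightarrow> x \<notin> node_basis \<sigma>"
  by (auto simp: measure_pmf_zero_iff node_basis_eq)

locale monitoring_network =
  fixes U :: "'u set" and L :: "'x set"
    and \<phi> :: "'u \<Rightarrow> real" and mon :: "'x \<Rightarrow> 'u set" and r :: nat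
  assumes finite_U: "finite U" and finite_L: "finite L"
    and level: "\<And>u. u \<in> U \<Longrightarrow> 0 \<le> \<phi> u \<and> \<phi> u < 1"
    and mon: "\<And>x. x \<in> L \<Longrightarrow> mon x \<noteq> {} \<and> mon x \<subseteq> U"
    and covered_L: "covered mon L = U"
    and r_pos: "0 < r" and r_less: "r < min_cover_size U L mon"
begin

abbreviation "strategies \<equiv> monitoring_strategies L r"

lemma r_less_card_cover:
  assumes "C \<subseteq> L" and "covered mon C = U"
  shows "r < card C"
proof -
  have "{C. set_cover U L mon C} \<subseteq> Pow L"
    by (auto simp: set_cover_def)
  then have "finite (card ` {C. set_cover U L mon C})"
    using finite_L by (meson finite_Pow_iff finite_imageI finite_subset)
  moreover have "card C \<in> card ` {C. set_cover U L mon C}"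
    using assms by (auto simp: set_cover_def)
  ultimately have "min_cover_size U L mon \<le> card C"
    unfolding min_cover_size_def by (rule Min_le)
  then show ?thesis
    using r_less by simp
qed

lemma covered_subset: "C \<subseteq> L \<Longrightarrow> covered mon C \<subseteq> U"
  using mon by (fastforce simp: covered_def)

lemma U_nonempty: "U \<noteq> {}"
  using r_less_card_cover[of "{}"] by (auto simp: covered_def)

lemma phi_bar_le: "x \<in> L \<Longrightarrow> u \<in> mon x \<Longrightarrow> phi_bar \<phi> mon x \<le> \<phi> u"
  unfolding phi_bar_def using mon[of x] finite_U
  by (intro Min_le finite_imageI imageI) (auto intro: finite_subset)

lemma phi_bar_less_one: "x \<in> L \<Longrightarrow> phi_bar \<phi> mon x < 1"
proof -
  assume x: "x \<in> L"
  then obtain u where u: "u \<in> mon x" "u \<in> U"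
    using mon[OF x] by blast
  show ?thesis
    using phi_bar_le[OF x u(1)] level[OF u(2)] by simp
qed

text \<open>
  A set of at most \<open>r\<close> locations is not a cover, so for such a set the uncovered components, and not
  the locations, limit the value of the restricted problem.
\<close>

lemma min_uncovered_less_one:
  assumes "C \<subseteq> L" and "card C \<le> r"
  shows "min_uncovered U \<phi> mon C < 1"
proof -
  have "covered mon C \<noteq> U"
    using r_less_card_cover[OF assms(1)] assms(2) by (auto simp: not_less[symmetric])
  then obtain u where u: "u \<in> U" "u \<notin> covered mon C"
    using covered_subset[OF assms(1)] by blast
  then have "min_uncovered U \<phi> mon C \<le> ereal (\<phi> u)"
    unfolding min_uncovered_def by (intro INF_lower) auto
  also have "\<dots> < 1"
    using level[OF u(1)] by simp
  finally show ?thesis .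
qed

lemma strategyD:
  assumes "\<sigma> \<in> strategies" and "X \<in> set_pmf \<sigma>"
  shows "X \<subseteq> L" and "card X \<le> r" and "finite X"
proof -
  show "X \<subseteq> L" "card X \<le> r"
    using assms by (auto simp: monitoring_strategies_def placements_def)
  then show "finite X"
    using finite_L finite_subset by blast
qed

lemma node_basis_subset: "\<sigma> \<in> strategies \<Longrightarrow> node_basis \<sigma> \<subseteq> L"
  using strategyD(1) by (fastforce simp: node_basis_eq)

section \<open>Upper bounds\<close>

text \<open>
  A sensor covers at most one element of a set packing, so a placement covers at most \<open>r\<close> of them.
\<close>

lemma objective_M_le_packing_bound:
  assumes \<sigma>: "\<sigma> \<in> strategies" and T: "set_packing U L mon T"
  shows "objective_M U \<phi> mon \<sigma> \<le> packing_bound \<phi> r T"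
proof (cases "T = {}")
  case False
  have TU: "T \<subseteq> U" and finite_T: "finite T"
    using T finite_U finite_subset by (auto simp: set_packing_def)
  have covers_few: "card {u \<in> T. u \<in> covered mon X} \<le> r" if X: "X \<in> set_pmf \<sigma>" for X
  proof -
    have "{u \<in> T. u \<in> covered mon X} = (\<Union>x\<in>X. T \<inter> mon x)"
      by (auto simp: covered_def)
    also have "card \<dots> \<le> (\<Sum>x\<in>X. card (T \<inter> mon x))"
      by (rule card_UN_le) (rule strategyD(3)[OF \<sigma> X])
    also have "\<dots> \<le> (\<Sum>x\<in>X. 1)"
      using T strategyD(1)[OF \<sigma> X] by (intro sum_mono) (auto simp: set_packing_def)
    also have "\<dots> \<le> r"
      using strategyD(2)[OF \<sigma> X] by simp
    finally show ?thesis .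
  qed
  have "objective_M U \<phi> mon \<sigma>
      \<le> (INF u\<in>T. ereal (measure_pmf.expectation \<sigma> (\<lambda>X. detect \<phi> mon X u)))"
    unfolding objective_M_def by (rule INF_superset_mono) (use TU in auto)
  also have "\<dots> \<le> ereal (1 - (real (card T) - real r) / (\<Sum>u\<in>T. inverse (1 - \<phi> u)))"
    unfolding expectation_detect
    by (rule level_bound[OF finite_T False]) (use TU level sum_prob_le[OF finite_T covers_few] in auto)
  finally show ?thesis
    using False by (simp add: packing_bound_def packing_sum_def)
qed (simp add: packing_bound_def)

lemma objective_R_le_level:
  assumes \<sigma>: "\<sigma> \<in> strategies" and CL: "C \<subseteq> L" and D: "D \<subseteq> C" "D \<noteq> {}"
  shows "objective_R \<phi> mon C \<sigma>
           \<le> ereal (1 - (real (card D) - real r) / (\<Sum>x\<in>D. inverse (1 - phi_bar \<phi> mon x)))"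
proof -
  have finite_D: "finite D"
    by (rule finite_subset[OF order_trans[OF D(1) CL] finite_L])
  have few: "card {x \<in> D. x \<in> X} \<le> r" if X: "X \<in> set_pmf \<sigma>" for X
  proof -
    have "card {x \<in> D. x \<in> X} \<le> card X"
      by (rule card_mono[OF strategyD(3)[OF \<sigma> X]]) auto
    then show ?thesis
      using strategyD(2)[OF \<sigma> X] by simp
  qed
  have "objective_R \<phi> mon C \<sigma>
      \<le> (INF x\<in>D. ereal (measure_pmf.expectation \<sigma> (\<lambda>X. detect_bar \<phi> mon X x)))"
    unfolding objective_R_def by (rule INF_superset_mono) (use D in auto)
  also have "\<dots> \<le> ereal (1 - (real (card D) - real r) / (\<Sum>x\<in>D. inverse (1 - phi_bar \<phi> mon x)))"
    unfolding expectation_detect_bar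
    by (rule level_bound[OF finite_D D(2)])
      (use CL D(1) phi_bar_less_one sum_prob_le[OF finite_D few] in auto)
  finally show ?thesis .
qed

section \<open>Optimality of water filling\<close>

lemma water_filling:
  assumes "C \<subseteq> L" and "C \<noteq> {}"
    and "distinct xs" "set xs = C" "sorted (map (phi_bar \<phi> mon) xs)"
  shows "water_filling \<phi> mon r C xs"
  using assms phi_bar_less_one r_pos by unfold_locales auto

lemma exists_sorted_enumeration:
  assumes "C \<subseteq> L"
  obtains xs where "distinct xs" "set xs = C" "sorted (map (phi_bar \<phi> mon) xs)"
proof -
  obtain ys where "set ys = C" "distinct ys"
    using finite_distinct_list finite_subset[OF assms finite_L] by blast
  then show thesis
    by (intro that[of "sort_key (phi_bar \<phi> mon) ys"]) auto
qed

text \<open>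
  On the head this is the solution \<open>p\<close> of \<open>1 - (1 - p) * (1 - phi_bar \<phi> mon x) = v\<close>, where \<open>v\<close> is the
  water level \<open>1 - (k\<^sup>* - r) / S\<^sup>*\<close>.
\<close>

definition water_filling_marginal :: "'x set \<Rightarrow> 'x list \<Rightarrow> 'x \<Rightarrow> real" where
  "water_filling_marginal C xs x =
     (if x \<in> set (take (k_star \<phi> mon r C) xs)
      then 1 - (real (k_star \<phi> mon r C) - real r)
                 / ((1 - phi_bar \<phi> mon x) * S_star \<phi> mon r C)
      else 0)"

lemma objective_R_le_cover_bound:
  assumes \<sigma>: "\<sigma> \<in> strategies" and C: "C \<subseteq> L"
  shows "objective_R \<phi> mon C \<sigma> \<le> cover_bound \<phi> mon r C"
proof (cases "C = {}")
  case False
  obtain xs where xs: "distinct xs" "set xs = C" "sorted (map (phi_bar \<phi> mon) xs)"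
    using exists_sorted_enumeration[OF C] .
  interpret W: water_filling \<phi> mon r C xs
    by (rule water_filling[OF C False xs])
  have "W.head \<noteq> {}"
    using W.card_head W.k_star_pos by (metis card.empty less_irrefl)
  then show ?thesis
    using objective_R_le_level[OF \<sigma> C W.head_subset] False
    by (simp add: cover_bound_def W.S_star_eq W.card_head)
qed (simp add: cover_bound_def)

text \<open>
  The marginals are chosen so that each location in the head has expected value exactly the water
  level; the others are above it without any sensor.
\<close>

lemma cover_bound_le_objective_R:
  assumes C: "C \<subseteq> L" "C \<noteq> {}"
    and xs: "distinct xs" "set xs = C" "sorted (map (phi_bar \<phi> mon) xs)"
    and marginal: "\<And>x. x \<in> C \<Longrightarrow> measure_pmf.prob \<sigma> {X. x \<in> X} = water_filling_marginal C xs x"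
  shows "cover_bound \<phi> mon r C \<le> objective_R \<phi> mon C \<sigma>"
proof -
  interpret W: water_filling \<phi> mon r C xs
    by (rule water_filling[OF C xs])
  have "W.level \<le> measure_pmf.expectation \<sigma> (\<lambda>X. detect_bar \<phi> mon X x)" if x: "x \<in> C" for x
  proof (cases "x \<in> W.head")
    case True
    then show ?thesis
      using marginal[OF x] W.less_one[OF x]
      by (simp add: expectation_detect_bar water_filling_marginal_def)
  next
    case False
    then show ?thesis
      using marginal[OF x] W.level_less_tail[of x] x
      by (simp add: expectation_detect_bar water_filling_marginal_def)
  qed
  then show ?thesis
    using C(2) by (auto simp: cover_bound_def objective_R_def intro: INF_greatest)
qed

text \<open>
  Nonnegativity of the marginals is the statement that the head lies below the water level. They
  add up to \<open>k\<^sup>* - (k\<^sup>* - r) = r\<close>.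
\<close>

lemma water_filling_marginal_realizable:
  assumes C: "C \<subseteq> L" "r \<le> card C"
    and xs: "distinct xs" "set xs = C" "sorted (map (phi_bar \<phi> mon) xs)"
  shows "realizable L r (water_filling_marginal C xs)"
proof (rule realizable_if_sum_le[OF finite_L])
  have "C \<noteq> {}"
    using C(2) r_pos by auto
  then interpret W: water_filling \<phi> mon r C xs
    using water_filling[OF C(1) _ xs] by blast
  let ?S = "S_star \<phi> mon r C"
  have excess: "real W.k - real r \<ge> 0"
    using W.le_k_star[OF C(2)] by simp
  have on_head: "0 \<le> water_filling_marginal C xs x \<and> water_filling_marginal C xs x \<le> 1"
    if x: "x \<in> W.head" for x
  proof -
    have b: "1 - W.b x > 0"
      using W.less_one W.head_subset x by auto
    have "(real W.k - real r) / ?S \<le> 1 - W.b x"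
      using W.head_le_level[OF x] by simp
    then have "(real W.k - real r) / ((1 - W.b x) * ?S) \<le> 1"
      using b W.S_star_pos by (simp add: divide_simps)
    moreover have "(real W.k - real r) / ((1 - W.b x) * ?S) \<ge> 0"
      using b W.S_star_pos excess by simp
    ultimately show ?thesis
      using x by (simp add: water_filling_marginal_def)
  qed
  then show "0 \<le> water_filling_marginal C xs x \<and> water_filling_marginal C xs x \<le> 1" for x
    by (cases "x \<in> W.head") (simp_all add: water_filling_marginal_def)
  have "sum (water_filling_marginal C xs) L = sum (water_filling_marginal C xs) W.head"
    using W.head_subset C(1) finite_L
    by (intro sum.mono_neutral_right) (auto simp: water_filling_marginal_def)
  also have "\<dots> = (\<Sum>x\<in>W.head. 1 - (real W.k - real r) / ?S * inverse (1 - W.b x))"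
    by (intro sum.cong) (auto simp: water_filling_marginal_def field_simps)
  also have "\<dots> = real W.k - (real W.k - real r) / ?S * (\<Sum>x\<in>W.head. inverse (1 - W.b x))"
    by (simp only: sum_subtractf sum_distrib_left) (simp add: W.card_head)
  also have "\<dots> = real r"
    using W.S_star_pos by (simp flip: W.S_star_eq)
  finally show "sum (water_filling_marginal C xs) L \<le> real r"
    by simp
qed

section \<open>The restricted problem and the original problem\<close>

text \<open>
  A component covered by the node basis is at least as well protected as any location of the basis
  covering it: it is monitored whenever the location is chosen, and its own security level is at
  least that of the location. Any other component keeps its own security level.
\<close>

lemma objective_M_bar_le_objective_M:
  assumes \<sigma>: "\<sigma> \<in> strategies"
  shows "objective_M_bar U \<phi> mon \<sigma> \<le> objective_M U \<phi> mon \<sigma>"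
  unfolding objective_M_def
proof (rule INF_greatest)
  fix u assume u: "u \<in> U"
  let ?E = "measure_pmf.expectation \<sigma>"
  show "objective_M_bar U \<phi> mon \<sigma> \<le> ereal (?E (\<lambda>X. detect \<phi> mon X u))"
  proof (cases "u \<in> covered mon (node_basis \<sigma>)")
    case True
    then obtain x where x: "x \<in> node_basis \<sigma>" "u \<in> mon x"
      by (auto simp: covered_def)
    have xL: "x \<in> L"
      using x(1) node_basis_subset[OF \<sigma>] by blast
    have "measure_pmf.prob \<sigma> {X. x \<in> X} \<le> measure_pmf.prob \<sigma> {X. u \<in> covered mon X}"
      using x(2) by (intro measure_pmf.finite_measure_mono) (auto simp: covered_def)
    then have "?E (\<lambda>X. detect_bar \<phi> mon X x) \<le> ?E (\<lambda>X. detect \<phi> mon X u)"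
      using phi_bar_le[OF xL x(2)] level[OF u] unfolding expectation_detect expectation_detect_bar
      by (intro diff_mono mult_mono) auto
    moreover have "objective_R \<phi> mon (node_basis \<sigma>) \<sigma> \<le> ereal (?E (\<lambda>X. detect_bar \<phi> mon X x))"
      unfolding objective_R_def by (rule INF_lower[OF x(1)])
    ultimately show ?thesis
      unfolding objective_M_bar_def by (meson ereal_less_eq(3) min.coboundedI1 order_trans)
  next
    case False
    have "(1 - measure_pmf.prob \<sigma> {X. u \<in> covered mon X}) * (1 - \<phi> u) \<le> 1 * (1 - \<phi> u)"
      using level[OF u] by (intro mult_right_mono) auto
    then have "\<phi> u \<le> ?E (\<lambda>X. detect \<phi> mon X u)"
      unfolding expectation_detect by simp
    moreover have "min_uncovered U \<phi> mon (node_basis \<sigma>) \<le> ereal (\<phi> u)"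
      unfolding min_uncovered_def using u False by (intro INF_lower) auto
    ultimately show ?thesis
      unfolding objective_M_bar_def by (meson ereal_less_eq(3) min.coboundedI2 order_trans)
  qed
qed

abbreviation "cover_value C \<equiv> min (cover_bound \<phi> mon r C) (min_uncovered U \<phi> mon C)"

lemma objective_M_bar_le_cover_value:
  assumes "\<sigma> \<in> strategies"
  shows "objective_M_bar U \<phi> mon \<sigma> \<le> cover_value (node_basis \<sigma>)"
  unfolding objective_M_bar_def
  using objective_R_le_cover_bound[OF assms node_basis_subset[OF assms]] by (rule min.mono) simp

text \<open>
  A set of at most \<open>r\<close> locations is occupied with certainty. A larger set is treated by water
  filling. The node basis of that strategy may be smaller than \<open>C\<close>, which uncovers further
  components; but a location of \<open>C\<close> that is never used has expected value \<^const>\<open>phi_bar\<close>, which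
  therefore is at least \<^const>\<open>cover_bound\<close>, and so are the levels of the components it would cover.
\<close>

lemma cover_value_le_objective_M_bar:
  assumes C: "C \<subseteq> L"
  shows "\<exists>\<sigma>\<in>strategies. cover_value C \<le> objective_M_bar U \<phi> mon \<sigma>"
proof (cases "card C \<le> r")
  case True
  define \<sigma> where "\<sigma> = return_pmf C"
  have "\<sigma> \<in> strategies"
    using C True by (simp add: \<sigma>_def monitoring_strategies_def placements_def)
  moreover have "node_basis \<sigma> = C"
    by (simp add: \<sigma>_def node_basis_eq)
  moreover have "1 \<le> objective_R \<phi> mon C \<sigma>"
    unfolding objective_R_def by (rule INF_greatest) (simp add: \<sigma>_def detect_bar_def)
  ultimately show ?thesis
    using min_uncovered_less_one[OF C True]
    by (intro bexI[of _ \<sigma>]) (auto simp: objective_M_bar_def min_le_iff_disj)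
next
  case False
  then have "C \<noteq> {}" and r: "r \<le> card C"
    by auto
  obtain xs where xs: "distinct xs" "set xs = C" "sorted (map (phi_bar \<phi> mon) xs)"
    using exists_sorted_enumeration[OF C] .
  obtain \<sigma> where \<sigma>: "\<sigma> \<in> strategies"
      and marginal: "\<And>x. x \<in> L \<Longrightarrow> measure_pmf.prob \<sigma> {X. x \<in> X} = water_filling_marginal C xs x"
    using water_filling_marginal_realizable[OF C r xs] unfolding realizable_def by blast
  have R: "cover_bound \<phi> mon r C \<le> objective_R \<phi> mon C \<sigma>"
    using marginal C by (intro cover_bound_le_objective_R[OF C \<open>C \<noteq> {}\<close> xs]) auto
  have basis: "node_basis \<sigma> \<subseteq> C"
  proof
    fix x assume x: "x \<in> node_basis \<sigma>"
    then have "water_filling_marginal C xs x \<noteq> 0"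
      using marginal[of x] node_basis_subset[OF \<sigma>] prob_eq_0_iff_not_node_basis[of \<sigma> x] by auto
    then show "x \<in> C"
      using xs(2) by (auto simp: water_filling_marginal_def dest: in_set_takeD split: if_splits)
  qed
  have "cover_value C \<le> objective_R \<phi> mon (node_basis \<sigma>) \<sigma>"
    using R INF_superset_mono[OF basis order_refl] unfolding objective_R_def
    by (meson min.coboundedI1 order_trans)
  moreover have "cover_value C \<le> min_uncovered U \<phi> mon (node_basis \<sigma>)"
    unfolding min_uncovered_def[of U \<phi> mon "node_basis \<sigma>"]
  proof (rule INF_greatest)
    fix u assume u: "u \<in> U - covered mon (node_basis \<sigma>)"
    show "cover_value C \<le> ereal (\<phi> u)"
    proof (cases "u \<in> covered mon C")
      case True
      then obtain x where x: "x \<in> C" "u \<in> mon x" "x \<notin> node_basis \<sigma>"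
        using u by (auto simp: covered_def)
      have "objective_R \<phi> mon C \<sigma> \<le> ereal (measure_pmf.expectation \<sigma> (\<lambda>X. detect_bar \<phi> mon X x))"
        unfolding objective_R_def by (rule INF_lower[OF x(1)])
      also have "\<dots> = ereal (phi_bar \<phi> mon x)"
        using x(3) prob_eq_0_iff_not_node_basis[of \<sigma> x] by (simp add: expectation_detect_bar)
      also have "\<dots> \<le> ereal (\<phi> u)"
        using phi_bar_le x C by auto
      finally show ?thesis
        using R by (meson min.coboundedI1 order_trans)
    next
      case False
      then have "min_uncovered U \<phi> mon C \<le> ereal (\<phi> u)"
        unfolding min_uncovered_def using u by (intro INF_lower) auto
      then show ?thesis
        by (rule min.coboundedI2)
    qed
  qed
  ultimately show ?thesis
    using \<sigma> by (intro bexI[of _ \<sigma>]) (simp_all add: objective_M_bar_def)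
qed

lemma objective_M_bar_arg_max:
  "\<exists>\<sigma>. is_arg_max (objective_M_bar U \<phi> mon) (\<lambda>\<sigma>. \<sigma> \<in> strategies) \<sigma>
       \<and> objective_M_bar U \<phi> mon \<sigma> = (MAX C\<in>Pow L. cover_value C)"
proof -
  have fin: "finite (cover_value ` Pow L)"
    using finite_L by simp
  have "(MAX C\<in>Pow L. cover_value C) \<in> cover_value ` Pow L"
    by (rule Max_in[OF fin]) auto
  then obtain C where C: "C \<subseteq> L" "(MAX C\<in>Pow L. cover_value C) = cover_value C"
    by auto
  obtain \<sigma> where \<sigma>: "\<sigma> \<in> strategies" "cover_value C \<le> objective_M_bar U \<phi> mon \<sigma>"
    using cover_value_le_objective_M_bar[OF C(1)] by blast
  have le: "objective_M_bar U \<phi> mon \<tau> \<le> (MAX C\<in>Pow L. cover_value C)" if \<tau>: "\<tau> \<in> strategies" for \<tau>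
    by (rule order_trans[OF objective_M_bar_le_cover_value[OF \<tau>] Max_ge[OF fin]])
      (use node_basis_subset[OF \<tau>] in blast)
  then have "objective_M_bar U \<phi> mon \<sigma> = (MAX C\<in>Pow L. cover_value C)"
    using \<sigma> C(2) by (metis antisym)
  then show ?thesis
    using le \<sigma>(1) by (auto simp: is_arg_max_linorder)
qed

lemma objective_M_arg_max:
  "\<exists>\<sigma>. is_arg_max (objective_M U \<phi> mon) (\<lambda>\<sigma>. \<sigma> \<in> strategies) \<sigma>"
proof -
  have "placements L r \<noteq> {}"
    by (auto simp: placements_def intro: exI[of _ "{}"])
  moreover have "\<bar>detect \<phi> mon X u\<bar> \<le> 1" if "u \<in> U" for X u
    using level[OF that] by (simp add: detect_def)
  ultimately show ?thesis
    using maximin_pmf_attained[OF finite_placements[OF finite_L] _ finite_U U_nonempty,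
        of r "detect \<phi> mon" 1]
    by (simp add: monitoring_strategies_def objective_M_def[abs_def])
qed

lemma objective_M_le_one: "objective_M U \<phi> mon \<sigma> \<le> 1"
proof -
  obtain u where u: "u \<in> U"
    using U_nonempty by blast
  have "0 \<le> (1 - measure_pmf.prob \<sigma> {X. u \<in> covered mon X}) * (1 - \<phi> u)"
    using level[OF u] by (intro mult_nonneg_nonneg) auto
  then show ?thesis
    unfolding objective_M_def expectation_detect
    by (intro INF_lower2[OF u]) simp
qed

lemma water_filling_optimal:
  assumes C: "C \<subseteq> L" "C \<noteq> {}"
    and xs: "distinct xs" "set xs = C" "sorted (map (phi_bar \<phi> mon) xs)"
    and \<sigma>: "\<sigma> \<in> strategies"
    and "\<And>x. x \<in> C \<Longrightarrow> measure_pmf.prob \<sigma> {X. x \<in> X} = water_filling_marginal C xs x"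
  shows "is_arg_max (objective_R \<phi> mon C) (\<lambda>\<sigma>. \<sigma> \<in> strategies) \<sigma>"
  unfolding is_arg_max_linorder
  using \<sigma> objective_R_le_cover_bound[OF _ C(1)] cover_bound_le_objective_R[OF C xs assms(7)]
  by (meson order_trans)

end

theorem theorem1:
  fixes U :: "'u set" and L :: "'x set"
    and \<phi> :: "'u \<Rightarrow> real" and mon :: "'x \<Rightarrow> 'u set" and r :: nat
  assumes "finite U" and "finite L"
    and "\<And>u. u \<in> U \<Longrightarrow> 0 \<le> \<phi> u \<and> \<phi> u < 1"
    and "\<And>x. x \<in> L \<Longrightarrow> mon x \<noteq> {} \<and> mon x \<subseteq> U"
    and "covered mon L = U"
    and "0 < r" and "r < min_cover_size U L mon"
  shows
    "(\<exists>\<sigma>. is_arg_max (objective_M U \<phi> mon) (\<lambda>\<sigma>. \<sigma> \<in> monitoring_strategies L r) \<sigma>)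
     \<and> (\<exists>\<sigma>. is_arg_max (objective_M_bar U \<phi> mon) (\<lambda>\<sigma>. \<sigma> \<in> monitoring_strategies L r) \<sigma>)
     \<and> z_M_bar U L \<phi> mon r =
         (MAX C\<in>Pow L. min (cover_bound \<phi> mon r C) (min_uncovered U \<phi> mon C))
     \<and> (MAX C\<in>Pow L. min (cover_bound \<phi> mon r C) (min_uncovered U \<phi> mon C)) \<le> z_M U L \<phi> mon r
     \<and> z_M U L \<phi> mon r \<le> min 1 (INF T\<in>{T. set_packing U L mon T}. packing_bound \<phi> r T)
     \<and> (\<forall>C xs \<sigma>'.
          C \<subseteq> L \<and> card C > r
          \<and> distinct xs \<and> set xs = C \<and> sorted (map (phi_bar \<phi> mon) xs)
          \<and> \<sigma>' \<in> monitoring_strategies L r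
          \<and> (\<forall>x\<in>L. measure_pmf.prob \<sigma>' {X. x \<in> X} =
               (if x \<in> set (take (k_star \<phi> mon r C) xs)
                then 1 - (real (k_star \<phi> mon r C) - real r)
                           / ((1 - phi_bar \<phi> mon x) * S_star \<phi> mon r C)
                else 0))
          \<longrightarrow> is_arg_max (objective_R \<phi> mon C) (\<lambda>\<sigma>. \<sigma> \<in> monitoring_strategies L r) \<sigma>')"
proof -
  interpret monitoring_network U L \<phi> mon r
    by unfold_locales (use assms in auto)
  obtain \<sigma> where \<sigma>: "is_arg_max (objective_M_bar U \<phi> mon) (\<lambda>\<sigma>. \<sigma> \<in> strategies) \<sigma>"
      and attained: "objective_M_bar U \<phi> mon \<sigma> = (MAX C\<in>Pow L. cover_value C)"
    using objective_M_bar_arg_max by blast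
  have z_M_bar: "z_M_bar U L \<phi> mon r = (MAX C\<in>Pow L. cover_value C)"
    unfolding z_M_bar_def attained[symmetric] using \<sigma>
    by (intro SUP_eqI) (auto simp: is_arg_max_linorder)
  have le: "z_M_bar U L \<phi> mon r \<le> z_M U L \<phi> mon r"
    unfolding z_M_bar_def z_M_def by (intro SUP_mono) (use objective_M_bar_le_objective_M in blast)
  have upper: "z_M U L \<phi> mon r \<le> min 1 (INF T\<in>{T. set_packing U L mon T}. packing_bound \<phi> r T)"
    unfolding z_M_def using objective_M_le_one objective_M_le_packing_bound
    by (intro SUP_least min.boundedI INF_greatest) auto
  have optimal: "is_arg_max (objective_R \<phi> mon C) (\<lambda>\<sigma>. \<sigma> \<in> strategies) \<sigma>'"
    if "C \<subseteq> L \<and> card C > r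
          \<and> distinct xs \<and> set xs = C \<and> sorted (map (phi_bar \<phi> mon) xs)
          \<and> \<sigma>' \<in> monitoring_strategies L r
          \<and> (\<forall>x\<in>L. measure_pmf.prob \<sigma>' {X. x \<in> X} =
               (if x \<in> set (take (k_star \<phi> mon r C) xs)
                then 1 - (real (k_star \<phi> mon r C) - real r)
                           / ((1 - phi_bar \<phi> mon x) * S_star \<phi> mon r C)
                else 0))" for C xs \<sigma>'
    by (rule water_filling_optimal) (use that in \<open>auto simp: water_filling_marginal_def\<close>)
  have M_bar_arg_max: "\<exists>\<sigma>. is_arg_max (objective_M_bar U \<phi> mon) (\<lambda>\<sigma>. \<sigma> \<in> strategies) \<sigma>"
    using \<sigma> by blast
  show ?thesis
    by (intro conjI allI impI; (rule objective_M_arg_max M_bar_arg_max z_M_bar le[unfolded z_M_bar] upper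
          | erule optimal))
qed

end
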